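(* Suppose that $C \subseteq (0,\infty)$ is an uncountable set and that $u_c, v_c, h_c \in \mathbb{R}$ are given for every $c \in C$. Let $g\colon \mathbb{R} \to \mathbb{R}$ be a continuous function satisfying $$g(x) = h_c\, g(cx + u_c) + v_c \qquad \text{for all } x \in \mathbb{R} \text{ and all } c \in C.$$ Then at least one of the following holds: (i) there exist $s \in \mathbb{R}$ with $s > 0$ and $a, b_1, b_2, d \in \mathbb{R}$ with $(b_1,b_2) \neq (0,0)$ such that $h_c = c^{-s}$ for all $c \in C$, $g(x) = a + b_1 (d-x)^s$ for all $x < d$, and $g(x) = a + b_2 (x-d)^s$ for all $x \geq d$; (ii) $g$ is constant. *)

theory Defs
  imports "HOL-Analysis.Analysis"
begin

end

(* Proof idea: assume that g is not constant.  If two of the maps x -> c x + u_c do not commute,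
   their commutator is a translation, which changes g by an additive constant.  Conjugating it
   with a dilation yields arbitrarily small translations with this property, so g satisfies
   Cauchy's equation up to a constant and is affine.  Otherwise all the maps have a common fixed
   point d, and F x = g (x + d) - g d satisfies F x = h_c F (c x).  The numbers c for which F (c x)
   is proportional to F x form an uncountable, hence dense, subgroup of the positive reals; by
   continuity it is the whole group, and the factor of proportionality is a power of c. *)

theory Submission
  imports Defs
begin

section \<open>Additive subgroups of the reals\<close>

text \<open>The integer multiples of an element of \<open>S\<close> in (0, e) come within e of every
  real, so \<open>S\<close> is dense, and closedness finishes.\<close>

lemma closed_real_subgroup_eq_UNIV:
  fixes S :: "real set"
  assumes "closed S"
    and diff: "\<And>x y. x \<in> S \<Longrightarrow> y \<in> S \<Longrightarrow> x - y \<in> S"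
    and small: "\<And>e. e > 0 \<Longrightarrow> \<exists>x\<in>S. 0 < x \<and> x < e"
  shows "S = UNIV"
proof -
  have zero: "0 \<in> S"
    using small[of 1] diff by fastforce
  have uminus: "- x \<in> S" if "x \<in> S" for x
    using diff[OF zero that] by simp
  have add: "x + y \<in> S" if "x \<in> S" "y \<in> S" for x y
    using diff[OF that(1) uminus[OF that(2)]] by simp
  have nat_mult: "of_nat n * x \<in> S" if "x \<in> S" for n :: nat and x
    by (induction n) (auto simp: zero distrib_right intro: add that)
  have int_mult: "of_int k * x \<in> S" if "x \<in> S" for k :: int and x
    using nat_mult[OF that] uminus[OF nat_mult[OF that]] by (cases k rule: int_cases2) auto
  have "t \<in> S" for t
  proof -
    have "\<exists>y\<in>S. dist y t < e" if e: "e > 0" for e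
    proof -
      obtain x where x: "x \<in> S" "0 < x" "x < e"
        using small[OF e] by auto
      have "of_int \<lfloor>t / x\<rfloor> * x \<le> t" "t < of_int \<lfloor>t / x\<rfloor> * x + x"
        using floor_divide_lower[OF x(2), of t] floor_divide_upper[OF x(2), of t]
        by (simp_all add: distrib_right)
      then have "dist (of_int \<lfloor>t / x\<rfloor> * x) t < e"
        using x by (simp add: dist_real_def)
      with int_mult[OF x(1)] show ?thesis by blast
    qed
    then show ?thesis
      using closed_approachable[OF \<open>closed S\<close>] by blast
  qed
  then show ?thesis by blast
qed

text \<open>Without an element in (0, e), distinct elements of \<open>S\<close> differ by at least
  e. Then the floor of \<open>x / e\<close> injects \<open>S\<close> into the integers.\<close>

lemma uncountable_real_subgroup_small_element:
  fixes S :: "real set"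
  assumes "uncountable S"
    and diff: "\<And>x y. x \<in> S \<Longrightarrow> y \<in> S \<Longrightarrow> x - y \<in> S"
    and "e > 0"
  shows "\<exists>x\<in>S. 0 < x \<and> x < e"
proof (rule ccontr)
  assume no_small: "\<not> ?thesis"
  have not_less: "\<not> x < y" if "x \<in> S" "y \<in> S" "\<lfloor>x / e\<rfloor> = \<lfloor>y / e\<rfloor>" for x y
  proof -
    have "of_int \<lfloor>x / e\<rfloor> * e \<le> x" "y < (of_int \<lfloor>x / e\<rfloor> + 1) * e"
      using floor_divide_lower[OF \<open>e > 0\<close>, of x] floor_divide_upper[OF \<open>e > 0\<close>, of y] that(3)
      by simp_all
    then have "y - x < e"
      by (simp add: distrib_right)
    then show ?thesis
      using no_small diff[OF that(2,1)] by force
  qed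
  have "inj_on (\<lambda>x. \<lfloor>x / e\<rfloor>) S"
    using not_less by (intro inj_onI) (metis linorder_neqE_linordered_idom)
  then have "countable S"
    by (rule countableI')
  with \<open>uncountable S\<close> show False by simp
qed

section \<open>Cauchy's functional equations\<close>

text \<open>The solutions \<open>t\<close> of the claimed equation form a closed subgroup that
  contains every 1/(n+1).\<close>

lemma continuous_additive_real_linear:
  fixes f :: "real \<Rightarrow> real"
  assumes cont: "continuous_on UNIV f"
    and add: "\<And>x y. f (x + y) = f x + f y"
  shows "f t = t * f 1"
proof -
  define S where "S = {t. f t = t * f 1}"
  have zero: "f 0 = 0"
    using add[of 0 0] by simp
  have "S = UNIV"
  proof (rule closed_real_subgroup_eq_UNIV)
    show "closed S"
      unfolding S_def by (intro closed_Collect_eq continuous_intros cont)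
    show "x - y \<in> S" if "x \<in> S" "y \<in> S" for x y
      using that add[of "x - y" y] by (simp add: S_def algebra_simps)
    show "\<exists>x\<in>S. 0 < x \<and> x < e" if e: "e > 0" for e
    proof -
      obtain n where n: "inverse (of_nat (Suc n)) < e"
        using reals_Archimedean[OF e] by blast
      have mult: "f (of_nat m * x) = of_nat m * f x" for m x
        by (induction m) (simp_all add: zero add distrib_right)
      have "inverse (of_nat (Suc n)) \<in> S"
        using mult[of "Suc n" "inverse (of_nat (Suc n))"]
        by (simp add: S_def field_simps del: of_nat_Suc)
      with n show ?thesis
        by (intro bexI[of _ "inverse (of_nat (Suc n))"]) auto
    qed
  qed
  then show ?thesis
    by (auto simp: S_def)
qed

text \<open>The substitution \<open>ln (\<phi> (exp t))\<close> reduces this to the additive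
  equation. The logarithm is available because \<open>\<phi> x\<close> is nonzero and the square of
  \<open>\<phi> (sqrt x)\<close>.\<close>

lemma continuous_multiplicative_eq_powr:
  fixes \<phi> :: "real \<Rightarrow> real"
  assumes cont: "continuous_on {0<..} \<phi>"
    and mult: "\<And>x y. x > 0 \<Longrightarrow> y > 0 \<Longrightarrow> \<phi> (x * y) = \<phi> x * \<phi> y"
    and one: "\<phi> 1 = 1"
  obtains s where "\<And>x. x > 0 \<Longrightarrow> \<phi> x = x powr s"
proof -
  have pos: "\<phi> x > 0" if "x > 0" for x
  proof -
    have "\<phi> x \<noteq> 0"
      using mult[of x "inverse x"] one that by auto
    moreover have "\<phi> x = \<phi> (sqrt x) * \<phi> (sqrt x)"
      using mult[of "sqrt x" "sqrt x"] that by simp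
    ultimately show ?thesis
      by (metis mult_zero_left not_real_square_gt_zero)
  qed
  define f where "f t = ln (\<phi> (exp t))" for t
  have "continuous_on UNIV f"
    unfolding f_def
  proof (intro continuous_on_ln continuous_on_compose2[OF cont] continuous_intros)
    show "\<forall>x\<in>UNIV. \<phi> (exp x) \<noteq> 0"
      using pos by (metis exp_gt_zero less_irrefl)
  qed auto
  moreover have "f (x + y) = f x + f y" for x y
    using pos[of "exp x"] pos[of "exp y"] by (simp add: f_def exp_add mult ln_mult)
  ultimately have lin: "f t = t * f 1" for t
    by (rule continuous_additive_real_linear)
  have "\<phi> x = x powr f 1" if "x > 0" for x
    using lin[of "ln x"] that pos[OF that] unfolding f_def
    by (metis exp_ln mult.commute powr_def less_irrefl)
  then show ?thesis by (rule that)
qed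

section \<open>Non-commuting maps: translations that shift \<open>g\<close> by a constant\<close>

lemma affine_if_translation_and_dilation:
  fixes g :: "real \<Rightarrow> real"
  assumes cont: "continuous_on UNIV g"
    and dil: "\<And>x. g x = h * g (c * x + u) + v"
    and c: "c > 0" "c \<noteq> 1"
    and trans: "\<And>x. g (x + \<tau>) = g x + w"
    and \<tau>: "\<tau> \<noteq> 0"
  shows "g x = g 0 + x * (g 1 - g 0)"
proof (cases "h = 0")
  case True
  then show ?thesis
    using dil by simp
next
  case False
  \<comment> \<open>The additive constant belonging to \<open>t\<close> must be
    \<open>g t - g 0\<close>. Writing it out instead of quantifying over it exhibits
    \<open>T\<close> as an intersection of closed sets.\<close>
  define T where "T = {t. \<forall>x. g (x + t) - g x = g t - g 0}"
  have T_iff: "t \<in> T \<longleftrightarrow> (\<exists>w. \<forall>x. g (x + t) = g x + w)" for t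
  proof
    assume "t \<in> T"
    then show "\<exists>w. \<forall>x. g (x + t) = g x + w"
      by (intro exI[of _ "g t - g 0"]) (auto simp: T_def algebra_simps)
  next
    assume "\<exists>w. \<forall>x. g (x + t) = g x + w"
    then obtain w where "\<And>x. g (x + t) = g x + w" by blast
    from this this[of 0] show "t \<in> T"
      by (simp add: T_def)
  qed
  have zero: "0 \<in> T"
    by (simp add: T_def)
  have diff: "x - y \<in> T" if xy: "x \<in> T" "y \<in> T" for x y
  proof -
    obtain a b where a: "\<And>z. g (z + x) = g z + a" and b: "\<And>z. g (z + y) = g z + b"
      using xy T_iff by metis
    have "g (z + (x - y)) = g z + (a - b)" for z
      using a[of "z - y"] b[of "z - y"] by (simp add: algebra_simps)
    then show ?thesis
      by (auto simp: T_iff)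
  qed
  \<comment> \<open>Conjugating the translation by \<open>t\<close> with the map x -> c x + u, or
    with its inverse, gives the translation by \<open>c * t\<close> or \<open>t / c\<close>. The
    contracting one of the two is used.\<close>
  have shrink: "\<exists>q. 0 < q \<and> q < 1 \<and> (\<forall>t\<in>T. q * t \<in> T)"
  proof (cases "c < 1")
    case True
    have "c * t \<in> T" if "t \<in> T" for t
    proof -
      obtain w where w: "\<And>z. g (z + t) = g z + w"
        using \<open>t \<in> T\<close> by (auto simp: T_iff)
      have "g (z + c * t) = g z + w / h" for z
      proof -
        define y where "y = (z - u) / c"
        have z: "z = c * y + u"
          using c by (simp add: y_def)
        show ?thesis
          using w[of y] dil[of y] dil[of "y + t"] \<open>h \<noteq> 0\<close> unfolding z
          by (simp add: field_simps)
      qed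
      then show ?thesis
        by (auto simp: T_iff)
    qed
    with True c show ?thesis by blast
  next
    case False
    have "inverse c * t \<in> T" if "t \<in> T" for t
    proof -
      obtain w where w: "\<And>z. g (z + t) = g z + w"
        using \<open>t \<in> T\<close> by (auto simp: T_iff)
      have "g (z + inverse c * t) = g z + h * w" for z
      proof -
        have "c * (z + inverse c * t) + u = (c * z + u) + t"
          using c by (simp add: field_simps)
        then show ?thesis
          using w[of "c * z + u"] dil[of z] dil[of "z + inverse c * t"]
          by (simp only:) (simp add: distrib_left)
      qed
      then show ?thesis
        by (auto simp: T_iff)
    qed
    moreover have "0 < inverse c" "inverse c < 1"
      using False c by (auto simp: field_simps)
    ultimately show ?thesis by blast
  qed
  have "T = UNIV"
  proof (rule closed_real_subgroup_eq_UNIV)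
    show "closed T"
      unfolding T_def
      by (intro closed_Collect_all closed_Collect_eq continuous_intros
          continuous_on_compose2[OF cont]) auto
    show "x - y \<in> T" if "x \<in> T" "y \<in> T" for x y
      using diff[OF that] .
    show "\<exists>x\<in>T. 0 < x \<and> x < e" if "e > 0" for e
    proof -
      obtain q where q: "0 < q" "q < 1" "\<And>t. t \<in> T \<Longrightarrow> q * t \<in> T"
        using shrink by blast
      have "\<tau> \<in> T"
        using trans by (auto simp: T_iff)
      then have "\<bar>\<tau>\<bar> \<in> T"
        using diff[OF zero, of \<tau>] by (auto simp: abs_if)
      then have powT: "q ^ n * \<bar>\<tau>\<bar> \<in> T" for n
        by (induction n) (auto simp: mult.assoc intro: q)
      obtain n where "q ^ n < e / \<bar>\<tau>\<bar>"
        using real_arch_pow_inv[of "e / \<bar>\<tau>\<bar>" q] q \<tau> \<open>e > 0\<close> by auto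
      then have "q ^ n * \<bar>\<tau>\<bar> < e" "0 < q ^ n * \<bar>\<tau>\<bar>"
        using \<tau> q by (auto simp: field_simps)
      with powT show ?thesis by blast
    qed
  qed
  then have T: "g (x + t) - g x = g t - g 0" for x t
    by (auto simp: T_def)
  have "g t - g 0 = t * (g 1 - g 0)" for t
    using continuous_additive_real_linear[of "\<lambda>x. g x - g 0" t] T
    by (force intro: continuous_intros cont simp: algebra_simps)
  then show ?thesis
    by (simp add: algebra_simps)
qed

section \<open>Common fixed point: homogeneity under all dilations\<close>

lemma uncountable_dilations_imp_all:
  fixes F h :: "real \<Rightarrow> real"
  assumes cont: "continuous_on UNIV F"
    and C: "C \<subseteq> {0<..}" "uncountable C"
    and dil: "\<And>c x. c \<in> C \<Longrightarrow> F x = h c * F (c * x)"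
    and h: "\<And>c. c \<in> C \<Longrightarrow> h c \<noteq> 0"
    and "c > 0"
  shows "F x * F (c * y) = F y * F (c * x)"
proof -
  \<comment> \<open>Logarithms turn the multiplicative group of dilation factors into an additive
    one. Requiring \<open>k \<noteq> 0\<close> makes it closed under differences.\<close>
  define M where "M = {t. \<exists>k. k \<noteq> 0 \<and> (\<forall>x. F (exp t * x) = k * F x)}"
  \<comment> \<open>Cross-multiplying eliminates the factor k, which makes the condition closed.\<close>
  define S where "S = {t. \<forall>x y. F x * F (exp t * y) = F y * F (exp t * x)}"
  have diff: "a - b \<in> M" if ab: "a \<in> M" "b \<in> M" for a b
  proof -
    obtain k where k: "k \<noteq> 0" "\<And>x. F (exp a * x) = k * F x"
      using ab(1) by (auto simp: M_def)
    obtain l where l: "l \<noteq> 0" "\<And>x. F (exp b * x) = l * F x"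
      using ab(2) by (auto simp: M_def)
    have "F (exp (a - b) * x) = (k / l) * F x" for x
      using k(2)[of "exp (- b) * x"] l(2)[of "exp (- b) * x"] l(1)
      by (simp add: exp_diff exp_minus field_simps)
    with k l show ?thesis
      by (auto simp: M_def intro!: exI[of _ "k / l"])
  qed
  have "ln ` C \<subseteq> M"
  proof
    fix t assume "t \<in> ln ` C"
    then obtain c where c: "c \<in> C" "t = ln c" by blast
    then have "exp t = c"
      using C(1) by auto
    then have "F (exp t * x) = inverse (h c) * F x" for x
      using dil[OF c(1), of x] h[OF c(1)] by simp
    then show "t \<in> M"
      using h[OF c(1)] by (auto simp: M_def intro!: exI[of _ "inverse (h c)"])
  qed
  moreover have "inj_on ln C"
    using C(1) by (intro inj_onI) (metis exp_ln greaterThan_iff subsetD)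
  ultimately have "uncountable M"
    using C(2) countable_image_inj_on countable_subset by blast
  then have small: "\<exists>t\<in>M. 0 < t \<and> t < e" if "e > 0" for e
    using uncountable_real_subgroup_small_element diff that by blast
  have MS: "closure M \<subseteq> S"
  proof (rule closure_minimal)
    show "M \<subseteq> S"
    proof
      fix t assume "t \<in> M"
      then obtain k where "\<And>x. F (exp t * x) = k * F x"
        by (auto simp: M_def)
      then show "t \<in> S"
        by (simp add: S_def)
    qed
    show "closed S"
      unfolding S_def
      by (intro closed_Collect_all closed_Collect_eq continuous_intros
          continuous_on_compose2[OF cont]) auto
  qed
  \<comment> \<open>Closedness of \<open>M\<close> itself is not established, so the subgroup lemma
    is applied to its closure, which inherits differences through limits.\<close>
  have "closure M = UNIV"
  proof (rule closed_real_subgroup_eq_UNIV)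
    show "x - y \<in> closure M" if xy: "x \<in> closure M" "y \<in> closure M" for x y
    proof -
      obtain X Y where "\<And>n. X n \<in> M" "X \<longlonglongrightarrow> x" "\<And>n. Y n \<in> M" "Y \<longlonglongrightarrow> y"
        using xy unfolding closure_sequential by blast
      then show ?thesis
        unfolding closure_sequential
        by (intro exI[of _ "\<lambda>n. X n - Y n"] conjI allI diff tendsto_diff) auto
    qed
    show "\<exists>x\<in>closure M. 0 < x \<and> x < e" if "e > 0" for e
      using small[OF that] closure_subset by blast
  qed simp
  with MS have "ln c \<in> S" by blast
  with \<open>c > 0\<close> show ?thesis
    by (simp add: S_def)
qed

text \<open>The ratio \<open>F (c * x0) / F x0\<close> is continuous and multiplicative in
  \<open>c\<close>, hence a power of \<open>c\<close>.\<close>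

lemma homogeneous_imp_power:
  fixes F :: "real \<Rightarrow> real"
  assumes cont: "continuous_on UNIV F"
    and F0: "F 0 = 0"
    and nz: "F x0 \<noteq> 0"
    and hom: "\<And>c x y. c > 0 \<Longrightarrow> F x * F (c * y) = F y * F (c * x)"
  shows "\<exists>s>0. \<forall>c>0. \<forall>x. F (c * x) = c powr s * F x"
proof -
  define \<phi> where "\<phi> c = F (c * x0) / F x0" for c
  have F: "F (c * y) = \<phi> c * F y" if "c > 0" for c y
    using hom[OF that, of x0 y] nz by (simp add: \<phi>_def field_simps)
  have cont_\<phi>: "continuous_on UNIV \<phi>"
    unfolding \<phi>_def
    by (intro continuous_intros continuous_on_compose2[OF cont]) (auto simp: nz)
  have "\<phi> (a * b) = \<phi> a * \<phi> b" if "a > 0" "b > 0" for a b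
    using F[of a "b * x0"] that by (simp add: \<phi>_def mult.assoc)
  moreover have "\<phi> 1 = 1"
    using nz by (simp add: \<phi>_def)
  ultimately obtain s where s: "\<And>x. x > 0 \<Longrightarrow> \<phi> x = x powr s"
    using continuous_multiplicative_eq_powr continuous_on_subset[OF cont_\<phi>] by blast
  \<comment> \<open>By \<open>F 0 = 0\<close> and continuity \<open>\<phi>\<close> tends to 0 at 0,
    whereas an exponent \<open>s \<le> 0\<close> would keep it at least 1 on (0, 1).\<close>
  have "s > 0"
  proof (rule ccontr)
    assume "\<not> s > 0"
    have "\<phi> \<midarrow>0\<rightarrow> \<phi> 0"
      using cont_\<phi> by (simp add: continuous_on_def)
    then have "(\<phi> \<longlongrightarrow> 0) (at_right 0)"
      by (auto simp: \<phi>_def F0 intro: filterlim_mono at_le)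
    moreover have "eventually (\<lambda>x. 1 \<le> \<phi> x) (at_right 0)"
      unfolding eventually_at_right_field
    proof (intro exI[of _ 1] conjI allI impI)
      fix x :: real assume "0 < x" "x < 1"
      then show "1 \<le> \<phi> x"
        using \<open>\<not> s > 0\<close> s[of x] powr_mono'[of s 0 x] by simp
    qed simp
    ultimately have "(1 :: real) \<le> 0"
      by (intro tendsto_lowerbound) auto
    then show False by simp
  qed
  then show ?thesis
    using F s by (intro exI[of _ s]) auto
qed

section \<open>The two cases combined\<close>

theorem theorem2p1:
  fixes C :: "real set" and u v h :: "real \<Rightarrow> real" and g :: "real \<Rightarrow> real"
  assumes "C \<subseteq> {0<..}"
    and "uncountable C"
    and "continuous_on UNIV g"
    and "\<And>x c. c \<in> C \<Longrightarrow> g x = h c * g (c * x + u c) + v c"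
  shows "(\<exists>s a b1 b2 d :: real. s > 0 \<and> (b1, b2) \<noteq> (0, 0)
            \<and> (\<forall>c\<in>C. h c = c powr (- s))
            \<and> (\<forall>x. x < d \<longrightarrow> g x = a + b1 * (d - x) powr s)
            \<and> (\<forall>x. x \<ge> d \<longrightarrow> g x = a + b2 * (x - d) powr s))
         \<or> (\<exists>k. \<forall>x. g x = k)"
proof (cases "\<exists>k. \<forall>x. g x = k")
  case True
  then show ?thesis by blast
next
  case nonconst: False
  note dil = assms(4)
  have hnz: "h c \<noteq> 0" if "c \<in> C" for c
    using dil[OF that] nonconst by (metis mult_zero_left)
  have "\<not> C \<subseteq> {1}"
    using assms(2) countable_subset[of C "{1}"] by auto
  then obtain c0 where c0: "c0 \<in> C" "c0 \<noteq> 1" by blast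
  have "c0 > 0"
    using c0 assms(1) by auto
  define P where "P s a b1 b2 d \<longleftrightarrow> s > 0 \<and> (b1, b2) \<noteq> (0, 0)
            \<and> (\<forall>c\<in>C. h c = c powr (- s))
            \<and> (\<forall>x. x < d \<longrightarrow> g x = a + b1 * (d - x) powr s)
            \<and> (\<forall>x. x \<ge> d \<longrightarrow> g x = a + b2 * (x - d) powr s)" for s a b1 b2 d :: real
  have "\<exists>s a b1 b2 d. P s a b1 b2 d"
  \<comment> \<open>The two sides are the constant terms of the two compositions of x -> c x + u c
    with the map of \<open>c0\<close>, so the condition says that every map commutes with that of
    \<open>c0\<close>.\<close>
  proof (cases "\<forall>c\<in>C. u c0 + c0 * u c = u c + c * u c0")
    case False
    then obtain c where c: "c \<in> C" "u c0 + c0 * u c \<noteq> u c + c * u c0" by blast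
    have "c > 0"
      using c assms(1) by auto
    define \<tau> where "\<tau> = (u c0 + c0 * u c) - (u c + c * u c0)"
    define w where "w = (h c0 * v c + v c0 - h c * v c0 - v c) / (h c * h c0)"
    have trans: "g (y + \<tau>) = g y + w" for y
    proof -
      \<comment> \<open>The point that one order of composition sends to \<open>y\<close>; the other
        order sends it to \<open>y + \<tau>\<close>. Expanding \<open>g x\<close> in both ways
        yields \<open>w\<close>.\<close>
      define x where "x = (y - u c - c * u c0) / (c * c0)"
      have y: "c * (c0 * x + u c0) + u c = y" and y': "c0 * (c * x + u c) + u c0 = y + \<tau>"
        using \<open>c > 0\<close> \<open>c0 > 0\<close> by (simp_all add: x_def \<tau>_def field_simps)
      have "h c0 * (h c * g y + v c) + v c0 = h c * (h c0 * g (y + \<tau>) + v c0) + v c"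
        using dil[OF c(1), of x] dil[OF c0(1), of x]
          dil[OF c(1), of "c0 * x + u c0"] dil[OF c0(1), of "c * x + u c"]
        unfolding y y' by simp
      then show ?thesis
        using hnz[OF c(1)] hnz[OF c0(1)] by (simp add: w_def field_simps)
    qed
    define b where "b = g 1 - g 0"
    have g: "g x = g 0 + x * b" for x
      unfolding b_def
    proof (rule affine_if_translation_and_dilation[where g = g])
      show "g x = h c0 * g (c0 * x + u c0) + v c0" for x
        by (rule dil[OF c0(1)])
      show "g (x + \<tau>) = g x + w" for x
        by (rule trans)
      show "\<tau> \<noteq> 0"
        using c(2) by (simp add: \<tau>_def)
    qed (use assms(3) c0 \<open>c0 > 0\<close> in auto)
    have "b \<noteq> 0"
    proof
      assume "b = 0"
      then have "g x = g 0" for x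
        using g[of x] by simp
      then show False
        using nonconst by blast
    qed
    \<comment> \<open>An affine \<open>g\<close> falls under the power form with exponent 1 and
      \<open>d = 0\<close>. Comparing slopes in the functional equation determines
      \<open>h\<close>.\<close>
    have "h a = a powr (- 1)" if "a \<in> C" for a
    proof -
      have "a > 0"
        using that assms(1) by auto
      have "g (a + u a) - g (u a) = a * b"
        using g[of "a + u a"] g[of "u a"] by (simp add: distrib_right)
      moreover have "b = h a * (g (a + u a) - g (u a))"
        using dil[OF that, of 0] dil[OF that, of 1] by (simp add: b_def right_diff_distrib)
      ultimately have "b = h a * (a * b)" by simp
      with \<open>b \<noteq> 0\<close> have "h a * a = 1" by simp
      with \<open>a > 0\<close> show ?thesis
        by (simp add: powr_minus field_simps)
    qed
    moreover have "g x = g 0 + (- b) * (0 - x) powr 1" if "x < 0" for x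
      using g[of x] that by (simp add: powr_one')
    moreover have "g x = g 0 + b * (x - 0) powr 1" if "x \<ge> 0" for x
      using g[of x] that by (simp add: powr_one')
    moreover have "(- b, b) \<noteq> (0, 0)"
      using \<open>b \<noteq> 0\<close> by simp
    ultimately have "P 1 (g 0) (- b) b 0"
      unfolding P_def using zero_less_one by blast
    then show ?thesis by blast
  next
    case True
    \<comment> \<open>The unique fixed point of the map of \<open>c0\<close>, where
      \<open>c0 \<noteq> 1\<close> is used. A map commuting with it must fix \<open>d\<close>
      too.\<close>
    define d where "d = u c0 / (1 - c0)"
    have "c * d + u c = d" if "c \<in> C" for c
      using bspec[OF True that] c0(2) by (simp add: d_def field_simps)
    then have ud: "u c = d - c * d" if "c \<in> C" for c
      using that by (metis add_diff_cancel_left')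
    define F where "F x = g (x + d) - g d" for x
    \<comment> \<open>Subtracting the equation at \<open>d\<close> from the one at
      \<open>x + d\<close> cancels \<open>v c\<close>.\<close>
    have FC: "F x = h c * F (c * x)" if "c \<in> C" for c x
      using dil[OF that, of "x + d"] dil[OF that, of d]
      by (simp add: F_def ud[OF that] algebra_simps)
    have cont: "continuous_on UNIV F"
      unfolding F_def by (intro continuous_intros continuous_on_compose2[OF assms(3)]) auto
    have F0: "F 0 = 0"
      by (simp add: F_def)
    have gF: "g x = g d + F (x - d)" for x
      by (simp add: F_def)
    obtain x0 where x0: "F x0 \<noteq> 0"
    proof (rule ccontr)
      assume "\<not> thesis"
      then have "g x = g d" for x
        using gF[of x] that by fastforce
      with nonconst show False by blast
    qed
    have hom: "F x * F (c * y) = F y * F (c * x)" if "c > 0" for c x y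
      using cont assms(1,2) FC hnz that
      by (rule uncountable_dilations_imp_all[where F = F and h = h])
    have "\<exists>s>0. \<forall>c>0. \<forall>x. F (c * x) = c powr s * F x"
      using cont F0 x0 hom by (rule homogeneous_imp_power)
    then obtain s where s: "s > 0" and power: "\<And>c x. c > 0 \<Longrightarrow> F (c * x) = c powr s * F x"
      by blast
    \<comment> \<open>Each half-line is the orbit of 1 or -1 under dilations, which supplies the
      coefficients. At 0 the convention \<open>0 powr s = 0\<close> agrees with
      \<open>F 0 = 0\<close>.\<close>
    have Fpos: "F x = F 1 * x powr s" if "x \<ge> 0" for x
      using power[of x 1] that F0 by (cases "x = 0") simp_all
    have Fneg: "F x = F (- 1) * (- x) powr s" if "x < 0" for x
      using power[of "- x" "- 1"] that by simp
    have "h c = c powr (- s)" if "c \<in> C" for c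
    proof -
      have "c > 0"
        using that assms(1) by auto
      then have "h c * c powr s = 1"
        using FC[OF that, of x0] power[of c x0] x0 by simp
      with \<open>c > 0\<close> show ?thesis
        by (simp add: powr_minus field_simps)
    qed
    moreover have "g x = g d + F (- 1) * (d - x) powr s" if "x < d" for x
      using gF[of x] Fneg[of "x - d"] that by simp
    moreover have "g x = g d + F 1 * (x - d) powr s" if "x \<ge> d" for x
      using gF[of x] Fpos[of "x - d"] that by simp
    moreover have "(F (- 1), F 1) \<noteq> (0, 0)"
      using x0 Fpos[of x0] Fneg[of x0] by (cases "x0 < 0") auto
    ultimately have "P s (g d) (F (- 1)) (F 1) d"
      using s unfolding P_def by blast
    then show ?thesis by blast
  qed
  then show ?thesis
    unfolding P_def by blast
qed

end
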